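(* Let $R,d,a,\lambda$ be positive and $\delta>1$, with $\lambda_k$ and $\beta_{k,l}(\lambda)$ as in the context. Assume $a>\frac{1}{3\sqrt3}$ and $d(\lambda-a)>(a+\lambda)^3+2\sqrt d(a+\lambda)^2$, and let the two positive roots $\lambda$ of $d(\lambda-a)=(a+\lambda)^3+2\sqrt d(a+\lambda)^2$ be $\lambda_{\min}$ and $\lambda_{\max}$. Let $I_\lambda$ be the open interval $$I_\lambda=\left(\tfrac{R^2}{2d}\left[d\tfrac{\lambda-a}{\lambda+a}-(\lambda+a)^2-\sqrt{D_\lambda}\right],\ \tfrac{R^2}{2d}\left[d\tfrac{\lambda-a}{\lambda+a}-(\lambda+a)^2+\sqrt{D_\lambda}\right]\right),\quad D_\lambda=\left[d\tfrac{\lambda-a}{\lambda+a}-(\lambda+a)^2\right]^2-4d(\lambda+a)^2 .$$ Further require that $\frac{R^2}{2d}(a+\lambda_{\min})\notin L=\{\lambda_k,\ k\in\mathbb N\}$ and that, for a certain $\epsilon>0$, the set $I_\lambda\cap L$ has exactly one element when $\lambda\in(\lambda_c,\lambda_c+\epsilon)$, where $$\lambda_c=\min\{\lambda:\ I_\lambda\cap L\neq\emptyset\}.$$ Let $k_c$ correspond to the only $\lambda_{k_c}$ that is inside $I_\lambda\cap L$ when $\lambda_c<\lambda<\lambda_c+\epsilon$. Then, treating $\lambda$ as the parameter, $$\beta_{k_c,2}(\lambda)\begin{cases}>0, & \lambda_c<\lambda<\lambda_c+\epsilon,\\ =0,&\lambda=\lambda_c,\\ <0,&0<\lambda<\lambda_c,\end{cases}$$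 and $$\operatorname{Re}\beta_{m,l}<0,\quad \beta_{k_c,1}<0,\qquad\text{where } m\neq k_c,\ 0<\lambda<\lambda_c+\epsilon .$$
   Context: $\Omega=\{(r,\theta):1\le r\le\delta,\ 0\le\theta<2\pi\}$ is an annulus, and $0=\lambda_0<\lambda_1\le\lambda_2\le\cdots$ are the eigenvalues of $-\Delta$ on $\Omega$ with Neumann boundary condition. For $\lambda>0$, $\beta_{k,1}(\lambda),\beta_{k,2}(\lambda)$ are the two roots $\beta$ of $$\Bigl(\beta-R^2\tfrac{\lambda-a}{\lambda+a}+\lambda_k\Bigr)\bigl(\beta+R^2(a+\lambda)^2+d\lambda_k\bigr)=-2R^4\lambda(a+\lambda),$$ with $\beta_{k,2}$ the root given by the plus sign in the quadratic formula. These are the eigenvalues of the linear problem $\Delta u+R^2[\frac{\lambda-a}{a+\lambda}u+(a+\lambda)^2v]=\beta u$, $d\Delta v-R^2[\frac{2\lambda}{a+\lambda}u+(a+\lambda)^2v]=\beta v$ in $\Omega$ with $u_r=v_r=0$ at $r=1,\delta$. The index $l$ ranges over $\{1,2\}$.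
   Formalization: λ_c is an infimum over λ>0 (the minimum does not exist); m≠k_c means λ_m≠λ_{k_c} (eigenvalues may be multiple); added: any λ_k in the closure of I_λ for some 0<λ<λ_c+ε lies in the open I_{λ'} for some λ'>0, since a merely touching eigenvalue gives β_{m,2}=0. *)

theory Defs
  imports "HOL-Analysis.Analysis" "HOL-Library.Function_Algebras"
begin

section \<open>Neumann eigenvalues of the annulus\<close>

text \<open>The closed annulus of radii \<^term>\<open>1\<close> and \<^term>\<open>\<delta>\<close>, in Cartesian coordinates.\<close>

definition annulus :: "real \<Rightarrow> (real^2) set" where
  "annulus \<delta> = {x. 1 \<le> norm x \<and> norm x \<le> \<delta>}"

text \<open>Classical solutions of the Neumann problem, that is, functions of class \<open>C\<^sup>2\<close> in the interior and
  \<open>C\<^sup>1\<close> up to the boundary: \<open>g\<close> is the gradient and \<open>H x\<close> the Hessian (as a linear map), so that the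
  trace of \<open>H x\<close> is the Laplacian. The outward unit normal at a boundary point \<open>x\<close> is \<open>sgn x\<close> or
  \<open>- sgn x\<close>, and \<open>g x \<bullet> sgn x\<close> is the radial derivative. Functions are normalised to vanish outside
  the annulus, so that solutions which agree on the annulus are equal.\<close>

definition neumann_eigenspace :: "real \<Rightarrow> real \<Rightarrow> (real^2 \<Rightarrow> real) set" where
  "neumann_eigenspace \<delta> \<mu> =
    {u. (\<forall>x. x \<notin> annulus \<delta> \<longrightarrow> u x = 0) \<and>
        (\<exists>(g :: real^2 \<Rightarrow> real^2) (H :: real^2 \<Rightarrow> real^2 \<Rightarrow> real^2).
           continuous_on (annulus \<delta>) g \<and>
           (\<forall>h. continuous_on (interior (annulus \<delta>)) (\<lambda>x. H x h)) \<and>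
           (\<forall>x \<in> annulus \<delta>. (u has_derivative (\<lambda>h. g x \<bullet> h)) (at x within annulus \<delta>)) \<and>
           (\<forall>x \<in> interior (annulus \<delta>). (g has_derivative H x) (at x)) \<and>
           (\<forall>x \<in> interior (annulus \<delta>). - (\<Sum>b\<in>Basis. H x b \<bullet> b) = \<mu> * u x) \<and>
           (\<forall>x. norm x = 1 \<or> norm x = \<delta> \<longrightarrow> g x \<bullet> sgn x = 0))}"

interpretation rfun: vector_space "\<lambda>(c::real) (u :: real^2 \<Rightarrow> real) x. c * u x"
  by unfold_locales (auto simp: fun_eq_iff algebra_simps)

text \<open>\<open>lam\<close> enumerates the Neumann eigenvalues in nondecreasing order, each one repeated according to
  its multiplicity, with \<open>0 = lam 0 < lam 1 \<le> lam 2 \<le> \<dots>\<close>.\<close>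

definition neumann_eigenvalues :: "real \<Rightarrow> (nat \<Rightarrow> real) \<Rightarrow> bool" where
  "neumann_eigenvalues \<delta> lam \<longleftrightarrow>
     lam 0 = 0 \<and> 0 < lam 1 \<and> mono lam \<and>
     (\<forall>\<mu>. finite {k. lam k = \<mu>} \<and>
          (\<exists>B. finite B \<and> \<not> rfun.dependent B \<and> rfun.span B = neumann_eigenspace \<delta> \<mu> \<and>
               card B = card {k. lam k = \<mu>}))"


section \<open>The roots of the characteristic equation\<close>

text \<open>Expanding \<open>(\<beta> - P) * (\<beta> + Q) = - S\<close> with
  \<open>P = R\<^sup>2 (x - a) / (x + a) - \<mu>\<close>, \<open>Q = R\<^sup>2 (a + x)\<^sup>2 + d \<mu>\<close>, \<open>S = 2 R\<^sup>4 x (a + x)\<close> gives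
  \<open>\<beta>\<^sup>2 + (Q - P) \<beta> + (S - P Q) = 0\<close>. The complex square root \<^const>\<open>csqrt\<close> is the principal one; it is the
  nonnegative real root when the discriminant is a nonnegative real. The parameter \<open>x\<close> is
  the \<open>\<lambda>\<close> of the problem.\<close>

definition char_b :: "real \<Rightarrow> real \<Rightarrow> real \<Rightarrow> real \<Rightarrow> real \<Rightarrow> real" where
  "char_b R d a \<mu> x =
     (R^2 * (a + x)^2 + d * \<mu>) - (R^2 * ((x - a) / (x + a)) - \<mu>)"

definition char_c :: "real \<Rightarrow> real \<Rightarrow> real \<Rightarrow> real \<Rightarrow> real \<Rightarrow> real" where
  "char_c R d a \<mu> x =
     2 * R^4 * x * (a + x) - (R^2 * ((x - a) / (x + a)) - \<mu>) * (R^2 * (a + x)^2 + d * \<mu>)"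

definition beta :: "real \<Rightarrow> real \<Rightarrow> real \<Rightarrow> (nat \<Rightarrow> real) \<Rightarrow> nat \<Rightarrow> nat \<Rightarrow> real \<Rightarrow> complex" where
  "beta R d a lam k l x =
     (- of_real (char_b R d a (lam k) x)
      + (if l = 2 then 1 else - 1) *
        csqrt (of_real ((char_b R d a (lam k) x)^2 - 4 * char_c R d a (lam k) x))) / 2"

lemma beta_roots:
  fixes z :: complex
  shows "(z - of_real (R^2 * ((x - a) / (x + a))) + of_real (lam k)) *
         (z + of_real (R^2 * (a + x)^2) + of_real (d * lam k))
           = - of_real (2 * R^4 * x * (a + x))
         \<longleftrightarrow> z = beta R d a lam k 1 x \<or> z = beta R d a lam k 2 x"
proof -
  define P where "P = R^2 * ((x - a) / (x + a))"
  define Q where "Q = R^2 * (a + x)^2"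
  define S where "S = 2 * R^4 * x * (a + x)"
  define b c where "b = char_b R d a (lam k) x" and "c = char_c R d a (lam k) x"
  define w where "w = csqrt (of_real (b^2 - 4 * c))"
  have w2: "w^2 = of_real b ^ 2 - 4 * of_real c"
    unfolding w_def by (simp add: power2_csqrt)
  have b: "b = (Q + d * lam k) - (P - lam k)" and c: "c = S - (P - lam k) * (Q + d * lam k)"
    unfolding b_def c_def char_b_def char_c_def P_def Q_def S_def by simp_all
  have "(z - of_real P + of_real (lam k)) * (z + of_real Q + of_real (d * lam k)) + of_real S
        = z^2 + of_real b * z + of_real c"
    unfolding b c by (simp add: algebra_simps power2_eq_square)
  also have "\<dots> = (z - (- of_real b - w) / 2) * (z - (- of_real b + w) / 2)"
  proof -
    have "4 * (z^2 + of_real b * z + of_real c) = (2 * z + of_real b)^2 - w^2"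
      unfolding w2 by (simp add: algebra_simps power2_eq_square)
    then show ?thesis by (simp add: field_simps power2_eq_square)
  qed
  finally have "(z - of_real P + of_real (lam k)) * (z + of_real Q + of_real (d * lam k)) = - of_real S
      \<longleftrightarrow> (z - (- of_real b - w) / 2) * (z - (- of_real b + w) / 2) = 0"
    by (simp add: eq_neg_iff_add_eq_0)
  moreover have "beta R d a lam k 1 x = (- of_real b - w) / 2"
    "beta R d a lam k 2 x = (- of_real b + w) / 2"
    unfolding beta_def b_def c_def w_def by simp_all
  ultimately show ?thesis
    unfolding P_def [symmetric] Q_def [symmetric] S_def [symmetric] by (simp only: mult_eq_0_iff right_minus_eq)
qed


section \<open>The critical interval and the critical parameter\<close>

definition Dlam :: "real \<Rightarrow> real \<Rightarrow> real \<Rightarrow> real" where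
  "Dlam d a x = (d * ((x - a) / (x + a)) - (x + a)^2)^2 - 4 * d * (x + a)^2"

text \<open>For \<^term>\<open>Dlam d a x < 0\<close> the endpoints are not real and the interval is meant to be empty. This
  is what the formula gives, since \<^const>\<open>sqrt\<close> is negative on negative reals.\<close>

definition Ilam :: "real \<Rightarrow> real \<Rightarrow> real \<Rightarrow> real \<Rightarrow> real set" where
  "Ilam R d a x =
     {R^2 / (2 * d) * (d * ((x - a) / (x + a)) - (x + a)^2 - sqrt (Dlam d a x)) <..<
      R^2 / (2 * d) * (d * ((x - a) / (x + a)) - (x + a)^2 + sqrt (Dlam d a x))}"

text \<open>The parameters whose interval meets the spectrum \<open>L\<close>. As the intervals are open and vary
  continuously, this set is open and has no least element: the ``minimum'' \<open>\<lambda>\<^sub>c\<close> has to be read as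
  its infimum, at which an eigenvalue is an endpoint of the interval.\<close>

definition unstable_set :: "real \<Rightarrow> real \<Rightarrow> real \<Rightarrow> real set \<Rightarrow> real set" where
  "unstable_set R d a L = {x. 0 < x \<and> Ilam R d a x \<inter> L \<noteq> {}}"

text \<open>No eigenvalue merely touches the family of intervals: one that lies in the closed interval
  for some parameter value below \<open>s\<close> lies in the open interval for some (other) value. An eigenvalue
  that only touches gives a root \<open>\<beta> = 0\<close> without ever being counted by \<open>Ilam \<inter> L\<close>, so that strict
  stability fails there.\<close>

definition no_tangency :: "real \<Rightarrow> real \<Rightarrow> real \<Rightarrow> real set \<Rightarrow> real \<Rightarrow> bool" where
  "no_tangency R d a L s \<longleftrightarrow>
     (\<forall>\<mu>\<in>L. \<forall>x. 0 < x \<and> x < s \<and> \<mu> \<in> closure (Ilam R d a x) \<longrightarrow> (\<exists>y>0. \<mu> \<in> Ilam R d a y))"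

end

theory Submission
  imports Defs
begin

text \<open>With \<open>s = a + x\<close> and \<open>\<nu> = \<mu> / R\<^sup>2\<close>, the constant term of the characteristic equation is
  \<open>R\<^sup>4 q(s) / s\<close>, where \<open>q(s) = (1 + \<nu>) s\<^sup>3 - d \<nu> (1 - \<nu>) s + 2 a d \<nu>\<close> is convex on \<open>s \<ge> 0\<close>; it is negative
  exactly when \<open>\<mu>\<close> lies in the critical interval. The condition \<open>a > 1 / (3 \<surd>3)\<close> says that
  \<open>s\<^sup>3 - s + 2 a > 0\<close> for \<open>s > 0\<close>. This makes the linear coefficient positive, so that stability is decided by
  the sign of \<open>q\<close>. It also gives \<open>(d - 1) \<nu> > 1\<close> as soon as \<open>q\<close> takes a nonpositive value, and then
  the discriminant is positive for every parameter by the arithmetic-geometric mean inequality.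
  Convexity shows that the critical eigenvalue has \<open>q > 0\<close> below \<open>\<lambda>\<^sub>c\<close>. For the other eigenvalues
  \<open>q \<ge> 0\<close>, and a zero of \<open>q\<close> would either be a tangency or sit at \<open>\<lambda>\<^sub>m\<^sub>i\<^sub>n\<close> or \<open>\<lambda>\<^sub>m\<^sub>a\<^sub>x\<close>, where it would force
  these two roots to coincide.\<close>

section \<open>The constant term as a cubic, and the critical interval\<close>

definition stability_cubic :: "real \<Rightarrow> real \<Rightarrow> real \<Rightarrow> real \<Rightarrow> real" where
  "stability_cubic d a \<nu> s = (1 + \<nu>) * s^3 - d * \<nu> * (1 - \<nu>) * s + 2 * a * d * \<nu>"

lemma char_c_eq_stability_cubic:
  assumes "R \<noteq> 0" "a + x \<noteq> 0"
  shows "char_c R d a \<mu> x = R^4 * stability_cubic d a (\<mu> / R^2) (a + x) / (a + x)"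
proof -
  define s where "s = a + x"
  have s: "s \<noteq> 0" "x + a = s" "x = s - a" using assms by (auto simp: s_def)
  define \<nu> where "\<nu> = \<mu> / R^2"
  have \<mu>: "\<mu> = R^2 * \<nu>" using assms by (simp add: \<nu>_def)
  have "char_c R d a \<mu> x * s = R^4 * stability_cubic d a \<nu> s"
    unfolding char_c_def stability_cubic_def \<mu> s_def[symmetric] s(2) using s(1)
    unfolding s(3) by (simp add: field_simps power2_eq_square power3_eq_cube power4_eq_xxxx)
  then show ?thesis
    using s(1) by (simp add: field_simps s_def \<nu>_def)
qed

lemma char_c_sign:
  assumes "R > 0" "a + x > 0"
  shows "char_c R d a \<mu> x < 0 \<longleftrightarrow> stability_cubic d a (\<mu> / R^2) (a + x) < 0"
    and "char_c R d a \<mu> x = 0 \<longleftrightarrow> stability_cubic d a (\<mu> / R^2) (a + x) = 0"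
  using assms by (auto simp: char_c_eq_stability_cubic divide_less_0_iff mult_less_0_iff)

text \<open>As a function of \<open>\<mu>\<close>, the constant term is a quadratic with leading
  coefficient \<open>d\<close>. Completing the square shows that its roots are the endpoints of
  \<open>Ilam\<close> when \<open>Dlam d a x\<close> is nonnegative.\<close>

lemma char_c_completed_square:
  assumes "a + x \<noteq> 0"
  shows "4 * d * char_c R d a \<mu> x =
    (2 * d * \<mu> - R^2 * (d * ((x - a) / (x + a)) - (x + a)^2))^2 - (R^2)^2 * Dlam d a x"
proof -
  define s where "s = x + a"
  have s: "s \<noteq> 0" "a + x = s" "x = s - a" using assms by (auto simp: s_def)
  define p where "p = (x - a) / s"
  have p: "x - a = p * s" using s(1) by (simp add: p_def)
  have x: "2 * x = p * s + s" using p s(3) by linarith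
  have c: "char_c R d a \<mu> x = R^4 * (2 * x) * s - (R^2 * p - \<mu>) * (R^2 * s^2 + d * \<mu>)"
    unfolding char_c_def s(2) s_def[symmetric] p_def[symmetric] by simp
  show ?thesis
    unfolding c x Dlam_def s_def[symmetric] p_def[symmetric]
    by (simp add: algebra_simps power2_eq_square power4_eq_xxxx)
qed

lemma Ilam_iff:
  assumes "R > 0" "d > 0" "a + x > 0"
  shows "\<mu> \<in> Ilam R d a x \<longleftrightarrow> char_c R d a \<mu> x < 0"
proof -
  define E where "E = d * ((x - a) / (x + a)) - (x + a)^2"
  define D where "D = Dlam d a x"
  have c: "4 * d * char_c R d a \<mu> x = (2 * d * \<mu> - R^2 * E)^2 - (R^2)^2 * D"
    unfolding E_def D_def using assms by (intro char_c_completed_square) simp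
  have "\<mu> \<in> Ilam R d a x \<longleftrightarrow> \<bar>2 * d * \<mu> - R^2 * E\<bar> < R^2 * sqrt D"
    unfolding Ilam_def E_def[symmetric] D_def[symmetric] using assms
    by (auto simp: field_simps abs_less_iff)
  also have "\<dots> \<longleftrightarrow> (2 * d * \<mu> - R^2 * E)^2 < (R^2)^2 * D"
  proof (cases "D \<ge> 0")
    case True
    then have "(R^2)^2 * D = (R^2 * sqrt D)^2" by (simp add: power_mult_distrib)
    moreover have "R^2 * sqrt D \<ge> 0" using True by simp
    ultimately show ?thesis
      by (metis power2_abs abs_ge_zero power_less_imp_less_base power_strict_mono zero_less_numeral)
  \<comment> \<open>The convention that \<open>sqrt\<close> is negative on negative reals makes both
    inequalities false here.\<close>
  next
    case False
    then have "R^2 * sqrt D < 0" "(R^2)^2 * D < 0" using assms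
      by (auto simp: mult_less_0_iff)
    then show ?thesis
      by (smt (verit) abs_ge_zero zero_le_power2)
  qed
  also have "\<dots> \<longleftrightarrow> char_c R d a \<mu> x < 0"
  proof -
    have "(2 * d * \<mu> - R^2 * E)^2 < (R^2)^2 * D \<longleftrightarrow> 4 * d * char_c R d a \<mu> x < 0"
      unfolding c by simp
    then show ?thesis using assms by (simp add: mult_less_0_iff)
  qed
  finally show ?thesis .
qed

lemma closure_Ilam:
  assumes "R > 0" "d > 0" "a + x > 0" "Dlam d a x > 0" "char_c R d a \<mu> x = 0"
  shows "\<mu> \<in> closure (Ilam R d a x)"
proof -
  define E where "E = d * ((x - a) / (x + a)) - (x + a)^2"
  define D where "D = Dlam d a x"
  have D: "sqrt D > 0" using assms by (simp add: D_def)
  have "(2 * d * \<mu> - R^2 * E)^2 = (R^2)^2 * D"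
    using char_c_completed_square[of a x d R \<mu>] assms unfolding E_def D_def by simp
  also have "\<dots> = (R^2 * sqrt D)^2" using D by (simp add: power_mult_distrib)
  finally have *: "2 * d * \<mu> - R^2 * E = R^2 * sqrt D \<or> 2 * d * \<mu> - R^2 * E = - (R^2 * sqrt D)"
    by (simp add: power2_eq_iff)
  \<comment> \<open>Strictness matters: a collapsed open interval is empty, and so is its
    closure.\<close>
  have lt: "R^2 / (2 * d) * (E - sqrt D) < R^2 / (2 * d) * (E + sqrt D)"
    using D assms by (intro mult_strict_left_mono) auto
  have "\<mu> = R^2 / (2 * d) * (E - sqrt D) \<or> \<mu> = R^2 / (2 * d) * (E + sqrt D)"
    using * assms by (auto simp: field_simps)
  then have "\<mu> \<in> {R^2 / (2 * d) * (E - sqrt D) .. R^2 / (2 * d) * (E + sqrt D)}"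
    using lt by auto
  then show ?thesis
    using lt unfolding Ilam_def E_def[symmetric] D_def[symmetric]
    by (simp only: closure_greaterThanLessThan)
qed

section \<open>Convexity, and the consequences of the lower bound on \<open>a\<close>\<close>

text \<open>By convexity on positive arguments, strict negativity at one endpoint suffices even if
  the cubic only vanishes at the other. The use of \<open>min\<close> and \<open>max\<close> leaves
  the order of the endpoints free.\<close>

lemma stability_cubic_neg_between:
  assumes "\<nu> \<ge> 0" "0 < s\<^sub>1" "0 < s\<^sub>2" "min s\<^sub>1 s\<^sub>2 < s" "s < max s\<^sub>1 s\<^sub>2"
    and "stability_cubic d a \<nu> s\<^sub>1 \<le> 0" "stability_cubic d a \<nu> s\<^sub>2 < 0"
  shows "stability_cubic d a \<nu> s < 0"
proof -
  let ?q = "stability_cubic d a \<nu>"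
  have chord: "(v - u) * ?q s \<le> (v - s) * ?q u + (s - u) * ?q v" if "0 < u" "u < s" "s < v" for u v
  proof -
    \<comment> \<open>Affine terms cancel in the chord defect, so only the cube contributes.\<close>
    have "(v - s) * ?q u + (s - u) * ?q v - (v - u) * ?q s =
        (1 + \<nu>) * ((v - s) * (s - u) * (v - u) * (u + s + v))"
      unfolding stability_cubic_def by (simp add: algebra_simps power3_eq_cube)
    moreover have "\<dots> \<ge> 0" using that assms by (intro mult_nonneg_nonneg) auto
    ultimately show ?thesis by simp
  qed
  consider "s\<^sub>1 < s" "s < s\<^sub>2" | "s\<^sub>2 < s" "s < s\<^sub>1" using assms by linarith
  then show ?thesis
  proof cases
    case 1
    then have "(s\<^sub>2 - s) * ?q s\<^sub>1 \<le> 0" "(s - s\<^sub>1) * ?q s\<^sub>2 < 0"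
      using assms by (auto simp: mult_le_0_iff mult_less_0_iff)
    then have "(s\<^sub>2 - s\<^sub>1) * ?q s < 0" using chord[of s\<^sub>1 s\<^sub>2] 1 assms by linarith
    then show ?thesis using 1 by (auto simp: mult_less_0_iff)
  next
    case 2
    then have "(s - s\<^sub>2) * ?q s\<^sub>1 \<le> 0" "(s\<^sub>1 - s) * ?q s\<^sub>2 < 0"
      using assms by (auto simp: mult_le_0_iff mult_less_0_iff)
    then have "(s\<^sub>1 - s\<^sub>2) * ?q s < 0" using chord[of s\<^sub>2 s\<^sub>1] 2 assms by linarith
    then show ?thesis using 2 by (auto simp: mult_less_0_iff)
  qed
qed

lemma continuous_stability_cubic:
  "continuous (at x) (\<lambda>x. stability_cubic d a \<nu> (a + x))"
  unfolding stability_cubic_def by (intro continuous_intros)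

text \<open>For \<open>a = 1 / (3 * sqrt 3)\<close> the cubic has the positive double root
  \<open>w = 1 / sqrt 3\<close> and third root \<open>- 2 * w\<close>; a larger \<open>a\<close>
  lifts it above zero.\<close>

lemma cubic_pos:
  fixes a s :: real
  assumes "a > 1 / (3 * sqrt 3)" "s > 0"
  shows "s^3 - s + 2 * a > 0"
proof -
  define w where "w = 1 / sqrt (3 :: real)"
  have w: "w > 0" "w * w = 1 / 3" by (auto simp: w_def)
  have "s^3 - s + 2 * w / 3 = s^3 - 3 * (w * w) * s + 2 * (w * w) * w"
    unfolding w(2) by simp
  also have "\<dots> = (s - w)^2 * (s + 2 * w)"
    by (simp add: algebra_simps power2_eq_square power3_eq_cube)
  also have "\<dots> \<ge> 0" using w assms by (intro mult_nonneg_nonneg) auto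
  finally show ?thesis using assms(1) by (simp add: w_def)
qed

text \<open>With \<open>s = a + x\<close>, the linear coefficient is
  \<open>R^2 * (s^3 - s + 2 * a) / s + (1 + d) * \<mu>\<close>.\<close>

lemma char_b_pos:
  assumes "R > 0" "d > 0" "a > 1 / (3 * sqrt 3)" "a + x > 0" "\<mu> \<ge> 0"
  shows "char_b R d a \<mu> x > 0"
proof -
  define s where "s = a + x"
  have s: "s > 0" "x + a = s" "x = s - a" using assms by (auto simp: s_def)
  have "(a + x)^2 - (x - a) / (x + a) = (s^3 - s + 2 * a) / s"
    unfolding s_def[symmetric] s(2) using s(1) unfolding s(3)
    by (simp add: field_simps power2_eq_square power3_eq_cube)
  also have "\<dots> > 0" using cubic_pos[of a s] assms s by simp
  finally have "R^2 * ((a + x)^2 - (x - a) / (x + a)) > 0" using assms by simp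
  moreover have "d * \<mu> \<ge> 0" using assms by simp
  ultimately show ?thesis using assms(5) unfolding char_b_def by (simp add: right_diff_distrib)
qed

text \<open>Otherwise \<open>d * \<nu>\<close> is at most the leading coefficient
  \<open>1 + \<nu>\<close>. Lowering that coefficient to \<open>d * \<nu>\<close> keeps the value
  nonpositive, and dividing by \<open>d * \<nu>\<close> contradicts
  \<open>cubic_pos\<close>.\<close>

lemma stability_cubic_nonpos_imp:
  assumes "d > 0" "a > 1 / (3 * sqrt 3)" "\<nu> \<ge> 0" "s > 0"
    and q: "stability_cubic d a \<nu> s \<le> 0"
  shows "(d - 1) * \<nu> > 1"
proof (rule ccontr)
  assume "\<not> (d - 1) * \<nu> > 1"
  then have k: "d * \<nu> \<le> 1 + \<nu>" by (simp add: algebra_simps)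
  have \<nu>: "\<nu> > 0"
  proof (rule ccontr)
    assume "\<not> \<nu> > 0"
    then have "\<nu> = 0" using assms by simp
    then show False using q assms by (simp add: stability_cubic_def)
  qed
  have "d * \<nu> * s^3 \<le> (1 + \<nu>) * s^3" using k assms by (intro mult_right_mono) auto
  then have "d * \<nu> * (s^3 - (1 - \<nu>) * s + 2 * a) \<le> 0"
    using q unfolding stability_cubic_def by (simp add: algebra_simps)
  then have "s^3 - (1 - \<nu>) * s + 2 * a \<le> 0"
    using \<nu> assms by (simp add: mult_le_0_iff zero_less_mult_iff)
  moreover have "\<nu> * s > 0" using \<nu> assms by simp
  ultimately have "s^3 - s + 2 * a \<le> 0" by (simp add: algebra_simps)
  then show False using cubic_pos[of a s] assms by simp
qed

text \<open>The discriminant of \<open>(\<beta> - P) * (\<beta> + Q) = - S\<close> is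
  \<open>(P + Q)^2 - 4 * S\<close>. Here \<open>P + Q\<close> is \<open>Z\<close>, \<open>S\<close>
  is \<open>R^4 * t * s^2\<close>, and AM-GM applies to \<open>t\<close> and \<open>s^2\<close>; the
  hypothesis on \<open>(d - 1) * \<mu>\<close> outweighs the \<open>- 1\<close> in
  \<open>Z\<close>.\<close>

lemma discriminant_pos:
  assumes "R > 0" "a > 0" "x > 0" "(d - 1) * \<mu> > R^2"
  shows "(char_b R d a \<mu> x)^2 - 4 * char_c R d a \<mu> x > 0"
proof -
  define s where "s = a + x"
  have s: "s > 0" "x + a = s" "a = s - x" using assms by (auto simp: s_def)
  define t where "t = 2 * x / s"
  have t: "t > 0" "(x - a) / s = t - 1" "2 * x = t * s" using assms s
    by (auto simp: t_def s(3) field_simps)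
  define Z where "Z = R^2 * (t - 1 + s^2) + (d - 1) * \<mu>"
  have disc: "(char_b R d a \<mu> x)^2 - 4 * char_c R d a \<mu> x = Z^2 - 4 * (R^2)^2 * (2 * x) * s"
    unfolding char_b_def char_c_def s_def[symmetric] s(2) t(2) Z_def
    by (simp add: algebra_simps power2_eq_square power4_eq_xxxx)
  have "4 * (R^2)^2 * (2 * x) * s \<le> (R^2 * (t + s^2))^2"
  proof -
    have "(R^2 * (t + s^2))^2 - 4 * (R^2)^2 * (t * s) * s = (R^2 * (t - s^2))^2"
      by (simp add: algebra_simps power2_eq_square)
    also have "\<dots> \<ge> 0" by simp
    finally show ?thesis unfolding t(3) by simp
  qed
  also have "\<dots> < Z^2"
  proof (rule power_strict_mono)
    show "R^2 * (t + s^2) < Z" using assms unfolding Z_def by (simp add: algebra_simps)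
    show "0 \<le> R^2 * (t + s^2)" using t by simp
  qed simp
  finally show ?thesis unfolding disc by simp
qed

section \<open>Signs of the roots\<close>

lemma beta_real:
  assumes "(char_b R d a (lam k) x)^2 - 4 * char_c R d a (lam k) x \<ge> 0"
  shows "beta R d a lam k l x = of_real ((- char_b R d a (lam k) x + (if l = 2 then 1 else - 1) *
    sqrt ((char_b R d a (lam k) x)^2 - 4 * char_c R d a (lam k) x)) / 2)"
proof -
  have "csqrt (of_real ((char_b R d a (lam k) x)^2 - 4 * char_c R d a (lam k) x)) =
      of_real (sqrt ((char_b R d a (lam k) x)^2 - 4 * char_c R d a (lam k) x))"
    using assms by (subst csqrt_of_real_nonneg) auto
  then show ?thesis unfolding beta_def by simp
qed

text \<open>Real roots are negative because the square root is smaller than the linear coefficient;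
  for nonreal roots the square root is purely imaginary and the real part is minus half that
  coefficient.\<close>

lemma Re_beta_neg:
  assumes "char_b R d a (lam k) x > 0" "char_c R d a (lam k) x > 0"
  shows "Re (beta R d a lam k l x) < 0"
proof -
  define b c where "b = char_b R d a (lam k) x" and "c = char_c R d a (lam k) x"
  have bc: "b > 0" "c > 0" using assms by (auto simp: b_def c_def)
  show ?thesis
  proof (cases "b^2 - 4 * c \<ge> 0")
    case True
    have "sqrt (b^2 - 4 * c) < b"
      using bc True by (intro real_less_lsqrt) auto
    moreover have "sqrt (b^2 - 4 * c) \<ge> 0" using True by simp
    ultimately show ?thesis
      using bc beta_real[of R d a lam k x l, folded b_def c_def, OF True]
      by (cases "l = 2") (simp_all del: real_sqrt_ge_0_iff of_real_add of_real_diff of_real_divide)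
  next
    case False
    then have "Re (csqrt (of_real (b^2 - 4 * c))) = 0"
      by (subst csqrt_of_real_nonpos) auto
    then show ?thesis
      unfolding beta_def b_def[symmetric] c_def[symmetric] using bc by auto
  qed
qed

lemma Re_beta_1_neg:
  assumes "char_b R d a (lam k) x > 0"
    "(char_b R d a (lam k) x)^2 - 4 * char_c R d a (lam k) x \<ge> 0"
  shows "Re (beta R d a lam k 1 x) < 0"
proof -
  have "sqrt ((char_b R d a (lam k) x)^2 - 4 * char_c R d a (lam k) x) \<ge> 0" using assms by simp
  then show ?thesis
    using assms(1) unfolding beta_real[of R d a lam k x, OF assms(2)] Re_complex_of_real by (simp del: real_sqrt_ge_0_iff)
qed

lemma Re_beta_2_pos:
  assumes "char_b R d a (lam k) x > 0" "char_c R d a (lam k) x < 0"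
  shows "Re (beta R d a lam k 2 x) > 0"
proof -
  define b c where "b = char_b R d a (lam k) x" and "c = char_c R d a (lam k) x"
  have bc: "b > 0" "c < 0" using assms by (auto simp: b_def c_def)
  have D: "b^2 - 4 * c \<ge> 0" using bc zero_le_power2[of b] by linarith
  have "b < sqrt (b^2 - 4 * c)" using bc by (intro real_less_rsqrt) auto
  then show ?thesis
    using beta_real[of R d a lam k x 2, folded b_def c_def, OF D]
    by (simp only: Re_complex_of_real) simp
qed

lemma beta_2_eq_0:
  assumes "char_b R d a (lam k) x > 0" "char_c R d a (lam k) x = 0"
  shows "beta R d a lam k 2 x = 0"
  using beta_real[of R d a lam k x 2] assms by simp

text \<open>At a zero of the cubic with \<^term>\<open>Dlam d a x = 0\<close> the interval is empty, so \<^const>\<open>no_tangency\<close> gives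
  nothing there. A tangential zero of this kind is a double root of the cubic that defines \<open>lmin\<close> and \<open>lmax\<close>,
  whose third root is negative.\<close>

lemma degenerate_zero_unique_root:
  assumes "d > 0" "a > 0" "x > 0" "R > 0" "\<mu> > 0"
    and D: "Dlam d a x = 0" and c: "char_c R d a \<mu> x = 0"
    and slope: "3 * (1 + \<mu> / R^2) * (a + x)^2 = d * (\<mu> / R^2) * (1 - \<mu> / R^2)"
  shows "{y. y > 0 \<and> d * (y - a) = (a + y)^3 + 2 * sqrt d * (a + y)^2} \<subseteq> {x}"
proof
  define s r \<nu> where "s = a + x" and "r = sqrt d" and "\<nu> = \<mu> / R^2"
  have r: "r > 0" "d = r^2" using assms by (auto simp: r_def)
  have s: "s > 0" "x + a = s" "x = s - a" using assms by (auto simp: s_def)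
  have \<nu>: "\<nu> > 0" "\<mu> = R^2 * \<nu>" using assms by (auto simp: \<nu>_def)
  define E where "E = d * ((x - a) / (x + a)) - (x + a)^2"
  have "2 * d * \<mu> - R^2 * E = 0"
    using char_c_completed_square[of a x d R \<mu>] assms unfolding E_def[symmetric] by simp
  then have "R^2 * (2 * d * \<nu> - E) = 0" unfolding \<nu>(2) by (simp add: algebra_simps)
  then have E: "E = 2 * d * \<nu>" using assms by simp
  have "E^2 - 4 * d * (x + a)^2 = 0"
    using D unfolding Dlam_def E_def .
  then have "E^2 = (2 * r * s)^2"
    unfolding s(2) r(2) by (simp add: power_mult_distrib)
  moreover have "E > 0" using E \<nu> assms by simp
  ultimately have E2: "E = 2 * r * s" using r s
    by (smt (verit) mult_pos_pos power2_eq_iff)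
  \<comment> \<open>This eliminates \<open>\<nu>\<close>, so that the slope condition becomes a
    relation between \<open>s\<close> and \<open>r\<close> alone.\<close>
  have rv: "r * \<nu> = s" using E E2 r by (simp add: power2_eq_square)
  have sl: "3 * (1 + \<nu>) * s^2 = r^2 * \<nu> * (1 - \<nu>)"
    using slope unfolding s_def[symmetric] \<nu>_def[symmetric] r(2) .
  have "r * (3 * (1 + \<nu>) * s^2) = r * (r^2 * \<nu> * (1 - \<nu>))" using sl by simp
  then have "3 * (r + r * \<nu>) * s^2 = r * (r * \<nu>) * (r - r * \<nu>)"
    by (simp add: algebra_simps power2_eq_square)
  then have "s * (3 * (r + s) * s) = s * (r * (r - s))"
    unfolding rv by (simp add: algebra_simps power2_eq_square)
  then have h': "3 * (r + s) * s = r * (r - s)" using s by simp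
  have "E * s = d * (s - 2 * a) - s^3"
    unfolding E_def s(2) using s(1) unfolding s(3)
    by (simp add: field_simps power2_eq_square power3_eq_cube)
  then have h: "r^2 * (s - 2 * a) = s^3 + 2 * r * s^2"
    unfolding E2 r(2) by (simp add: power2_eq_square algebra_simps)
  fix y assume "y \<in> {y. y > 0 \<and> d * (y - a) = (a + y)^3 + 2 * sqrt d * (a + y)^2}"
  then have y: "y > 0" "d * (y - a) = (a + y)^3 + 2 * sqrt d * (a + y)^2" by auto
  define t where "t = a + y"
  have t: "t > 0" using assms y by (simp add: t_def)
  have ya: "y - a = t - 2 * a" by (simp add: t_def)
  have ht: "r^2 * (t - 2 * a) = t^3 + 2 * r * t^2"
    using y(2) unfolding ya t_def[symmetric] r_def[symmetric] r(2)[symmetric] .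
  \<comment> \<open>\<open>h\<close> says that \<open>s\<close> is a root of the cubic and
    \<open>h'\<close> that its derivative vanishes there; the roots sum to \<open>- 2 * r\<close>,
    which gives the third one.\<close>
  have "(t - s)^2 * (t + 2 * s + 2 * r) = 0"
  proof -
    have "(t - s)^2 * (t + 2 * s + 2 * r) =
        (t^3 + 2 * r * t^2 - r^2 * (t - 2 * a)) - (s^3 + 2 * r * s^2 - r^2 * (s - 2 * a))
        + (t - s) * (r * (r - s) - 3 * (r + s) * s)"
      by (simp add: algebra_simps power2_eq_square power3_eq_cube)
    then show ?thesis using h ht h' by simp
  qed
  moreover have "t + 2 * s + 2 * r > 0" using t s r by simp
  ultimately have "t = s" by simp
  then show "y \<in> {x}" by (simp add: t_def s_def)
qed

section \<open>Exchange of stability at the critical parameter\<close>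

theorem theorem3p4:
  fixes R d a \<delta> \<epsilon> lmin lmax lc :: real
    and lam :: "nat \<Rightarrow> real" and kc :: nat
  assumes pos: "R > 0" "d > 0" "a > 0" and delta: "\<delta> > 1"
    and spectrum: "neumann_eigenvalues \<delta> lam"
    and a_large: "a > 1 / (3 * sqrt 3)"
    and nonempty: "\<exists>x>0. d * (x - a) > (a + x)^3 + 2 * sqrt d * (a + x)^2"
    and roots: "{x. x > 0 \<and> d * (x - a) = (a + x)^3 + 2 * sqrt d * (a + x)^2} = {lmin, lmax}"
      "lmin < lmax"
    and not_in_L: "R^2 / (2 * d) * (a + lmin) \<notin> range lam"
    and lc: "unstable_set R d a (range lam) \<noteq> {}" "lc = Inf (unstable_set R d a (range lam))"
    and eps: "\<epsilon> > 0"
    and single: "\<And>x. lc < x \<Longrightarrow> x < lc + \<epsilon> \<Longrightarrow> \<exists>!\<mu>. \<mu> \<in> Ilam R d a x \<inter> range lam"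
    and kc: "\<And>x. lc < x \<Longrightarrow> x < lc + \<epsilon> \<Longrightarrow> lam kc \<in> Ilam R d a x"
    and generic: "no_tangency R d a (range lam) (lc + \<epsilon>)"
  shows "(\<forall>x. lc < x \<and> x < lc + \<epsilon> \<longrightarrow>
            beta R d a lam kc 2 x \<in> \<real> \<and> Re (beta R d a lam kc 2 x) > 0) \<and>
         beta R d a lam kc 2 lc = 0 \<and>
         (\<forall>x. 0 < x \<and> x < lc \<longrightarrow>
            beta R d a lam kc 2 x \<in> \<real> \<and> Re (beta R d a lam kc 2 x) < 0) \<and>
         (\<forall>x. 0 < x \<and> x < lc + \<epsilon> \<longrightarrow>
            (\<forall>m l. lam m \<noteq> lam kc \<and> l \<in> {1, 2} \<longrightarrow> Re (beta R d a lam m l x) < 0) \<and>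
            beta R d a lam kc 1 x \<in> \<real> \<and> Re (beta R d a lam kc 1 x) < 0)"
proof -
  define q where "q m x = stability_cubic d a (lam m / R^2) (a + x)" for m x
  have lam_nonneg: "lam m \<ge> 0" for m
    using spectrum unfolding neumann_eigenvalues_def by (metis le0 monoD)
  have c_neg: "char_c R d a (lam m) x < 0 \<longleftrightarrow> q m x < 0" if "x > 0" for m x
    using that pos unfolding q_def by (intro char_c_sign) auto
  have c_zero: "char_c R d a (lam m) x = 0 \<longleftrightarrow> q m x = 0" if "x > 0" for m x
    using that pos unfolding q_def by (intro char_c_sign) auto
  have c_pos: "char_c R d a (lam m) x > 0 \<longleftrightarrow> q m x > 0" if "x > 0" for m x
    using c_neg[OF that, of m] c_zero[OF that, of m] by linarith
  have I: "lam m \<in> Ilam R d a x \<longleftrightarrow> q m x < 0" if "x > 0" for m x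
    using that pos Ilam_iff[of R d a x "lam m"] c_neg[of x m] by simp
  have b: "char_b R d a (lam m) x > 0" if "x > 0" for m x
    using that pos a_large lam_nonneg by (intro char_b_pos) auto
  have q_cont: "continuous (at x) (q m)" for m x
    unfolding q_def by (rule continuous_stability_cubic)
  have q_between: "q m z < 0"
    if "x > 0" "y > 0" "min x y < z" "z < max x y" "q m x \<le> 0" "q m y < 0" for m x y z
    unfolding q_def
    by (rule stability_cubic_neg_between[where s\<^sub>1 = "a + x" and s\<^sub>2 = "a + y"])
       (use that pos lam_nonneg[of m] in \<open>auto simp: q_def min_def max_def split: if_splits\<close>)
  let ?U = "unstable_set R d a (range lam)"
  have bdd: "bdd_below ?U" unfolding unstable_set_def by (auto intro: bdd_belowI[of _ 0])
  have U_iff: "x \<in> ?U \<longleftrightarrow> x > 0 \<and> (\<exists>m. q m x < 0)" for x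
    proof -
    have "Ilam R d a x \<inter> range lam \<noteq> {} \<longleftrightarrow> (\<exists>m. lam m \<in> Ilam R d a x)" by blast
    then show ?thesis unfolding unstable_set_def using I by auto
  qed
  \<comment> \<open>This keeps the infimum away from 0: for \<open>x < a\<close> every term of the
    cubic, regrouped, is nonnegative.\<close>
  have "x \<ge> a" if x: "x \<in> ?U" for x
  proof (rule ccontr)
    assume "\<not> x \<ge> a"
    obtain m where m: "x > 0" "q m x < 0" using x U_iff by auto
    define \<nu> where "\<nu> = lam m / R^2"
    have \<nu>: "\<nu> \<ge> 0" using lam_nonneg by (simp add: \<nu>_def)
    have "q m x = (1 + \<nu>) * (a + x)^3 + d * \<nu> * (a - x) + d * \<nu> * \<nu> * (a + x)"
      unfolding q_def stability_cubic_def \<nu>_def[symmetric] by (simp add: algebra_simps)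
    also have "\<dots> \<ge> 0" using \<nu> pos m \<open>\<not> x \<ge> a\<close>
      by (intro add_nonneg_nonneg mult_nonneg_nonneg) auto
    finally show False using m by simp
  qed
  then have "lc \<ge> a" using lc by (auto intro: cInf_greatest)
  then have lc_pos: "lc > 0" using pos by simp
  \<comment> \<open>The case \<open>x = lc\<close> is included by openness: a negative value would
    persist at a slightly smaller positive parameter, below the infimum.\<close>
  have q_below: "q m x \<ge> 0" if x: "0 < x" "x \<le> lc" for m x
  proof (rule ccontr)
    assume "\<not> q m x \<ge> 0"
    then have "q m x < 0" by simp
    then have "\<forall>\<^sub>F y in at x. q m y < 0"
      using q_cont[of x m] unfolding continuous_at by (auto intro: order_tendstoD)
    then obtain e where e: "e > 0" "\<And>y. y \<noteq> x \<Longrightarrow> dist y x < e \<Longrightarrow> q m y < 0"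
      unfolding eventually_at by auto
    define y where "y = max (x / 2) (x - e / 2)"
    have y: "0 < y" "y < x" "dist y x < e" using e x by (auto simp: y_def dist_real_def max_def)
    then have "y \<in> ?U" using U_iff e(2)[of y] by auto
    then have "lc \<le> y" using lc bdd by (auto intro: cInf_lower)
    then show False using y x by simp
  qed
  have q_kc_above: "q kc x < 0" if "lc < x" "x < lc + \<epsilon>" for x
    using kc[OF that] I[of x kc] that lc_pos by simp
  have q_kc_lc: "q kc lc = 0"
  proof (rule antisym)
    show "q kc lc \<le> 0"
    proof (rule tendsto_upperbound)
      show "(q kc \<longlongrightarrow> q kc lc) (at_right lc)"
        using q_cont[of lc kc] unfolding continuous_at by (rule tendsto_within_subset) simp
      show "\<forall>\<^sub>F x in at_right lc. q kc x \<le> 0"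
        using q_kc_above eps unfolding eventually_at_right_field
        by (intro exI[of _ "lc + \<epsilon>"]) (auto intro: less_imp_le)
    qed simp
  qed (use q_below lc_pos in simp)
  have q_kc_below: "q kc x > 0" if "0 < x" "x < lc" for x
  proof (rule ccontr)
    assume "\<not> q kc x > 0"
    then have "q kc lc < 0"
      \<comment> \<open>The point \<open>lc + \<epsilon> / 2\<close> supplies the strictly negative
        end of a chord passing over \<open>lc\<close>.\<close>
      using that eps by (intro q_between[of x "lc + \<epsilon> / 2" lc kc] q_kc_above) auto
    then show False using q_kc_lc by simp
  qed
  \<comment> \<open>Eigenvalues are compared instead of indices, since a multiple eigenvalue
    occupies several indices.\<close>
  have q_nonneg: "q m x \<ge> 0" if "0 < x" "x < lc + \<epsilon>" "lam m \<noteq> lam kc" for m x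
  proof (cases "x \<le> lc")
    case False
    then have x: "lc < x" "x < lc + \<epsilon>" using that by auto
    have "lam m \<notin> Ilam R d a x" using single[OF x] kc[OF x] that(3) by blast
    then show ?thesis using I[of x m] that by simp
  qed (use that q_below in simp)
  have q_pos: "q m x > 0" if x: "0 < x" "x < lc + \<epsilon>" and m: "lam m \<noteq> lam kc" for m x
  proof (rule ccontr)
    assume "\<not> q m x > 0"
    then have zero: "q m x = 0" using q_nonneg[OF x m] by simp
    have "lam m \<noteq> 0" using zero x pos by (auto simp: q_def stability_cubic_def)
    then have \<mu>: "lam m > 0" using lam_nonneg[of m] by simp
    have c: "char_c R d a (lam m) x = 0" using c_zero x zero by simp
    consider "Dlam d a x < 0" | "Dlam d a x = 0" | "Dlam d a x > 0" by linarith
    then show False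
    proof cases
      case 1
      have "(R^2)^2 * Dlam d a x < 0" using 1 pos by (simp add: mult_less_0_iff)
      moreover have "(2 * d * lam m - R^2 * (d * ((x - a) / (x + a)) - (x + a)^2))^2 =
          (R^2)^2 * Dlam d a x"
        using char_c_completed_square[of a x d R "lam m"] c x pos by simp
      ultimately show False using zero_le_power2 by (metis not_le)
    next
      case 2
      define \<nu> where "\<nu> = lam m / R^2"
      \<comment> \<open>A zero of a locally nonnegative function is a local minimum, which yields
        the slope condition.\<close>
      have "3 * (1 + \<nu>) * (a + x)^2 - d * \<nu> * (1 - \<nu>) = 0"
      proof (rule DERIV_local_min)
        show "DERIV (q m) x :> 3 * (1 + \<nu>) * (a + x)^2 - d * \<nu> * (1 - \<nu>)"
          unfolding q_def stability_cubic_def \<nu>_def[symmetric]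
          by (auto intro!: derivative_eq_intros)
        show "0 < min x (lc + \<epsilon> - x)" using x by simp
        show "\<forall>y. \<bar>x - y\<bar> < min x (lc + \<epsilon> - x) \<longrightarrow> q m x \<le> q m y"
          using q_nonneg[OF _ _ m] unfolding zero by auto
      qed
      then have "{lmin, lmax} \<subseteq> {x}"
        using degenerate_zero_unique_root[of d a x R "lam m"] pos x \<mu> 2 c
        unfolding roots(1) \<nu>_def by simp
      then show False using roots(2) by simp
    next
      case 3
      then have "lam m \<in> closure (Ilam R d a x)"
        using closure_Ilam pos x c by simp
      then obtain y where y: "y > 0" "lam m \<in> Ilam R d a y"
        using generic x unfolding no_tangency_def by blast
      then have qy: "q m y < 0" using I by simp
      \<comment> \<open>The first midpoint lies between \<open>x\<close> and \<open>y\<close>; the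
        second keeps \<open>z\<close> below \<open>lc + \<epsilon>\<close>, where
        \<open>q_nonneg\<close> applies.\<close>
      define z where "z = min ((x + y) / 2) ((x + lc + \<epsilon>) / 2)"
      have "min x y < z" "z < max x y" "0 < z" "z < lc + \<epsilon>"
        using x y qy zero lc_pos eps
        by (cases x y rule: linorder_cases; auto simp: z_def min_def max_def)+
      then show False
        using q_between[of x y z m] q_nonneg[of z m] qy y x zero m by simp
    qed
  qed
  \<comment> \<open>The zero at \<open>lc\<close> gives a bound free of the parameter, hence real
    roots for every \<open>x > 0\<close>.\<close>
  have "(d - 1) * (lam kc / R^2) > 1"
    using q_kc_lc pos a_large lam_nonneg lc_pos unfolding q_def
    by (intro stability_cubic_nonpos_imp[of d a _ "a + lc"]) auto
  then have "(d - 1) * lam kc > R^2" using pos by (simp add: field_simps)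
  then have disc: "(char_b R d a (lam kc) x)^2 - 4 * char_c R d a (lam kc) x \<ge> 0" if "x > 0" for x
    using discriminant_pos[of R a x d "lam kc"] that pos by simp
  have real: "beta R d a lam kc l x \<in> \<real>" if "x > 0" for l x
    unfolding beta_real[of R d a lam kc x, OF disc[OF that]] by (rule Reals_of_real)
  have "Re (beta R d a lam kc 2 x) > 0" if "lc < x" "x < lc + \<epsilon>" for x
    using that lc_pos q_kc_above[OF that] c_neg[of x kc] b by (intro Re_beta_2_pos) auto
  moreover have "beta R d a lam kc 2 lc = 0"
    using lc_pos q_kc_lc c_zero[of lc kc] b by (intro beta_2_eq_0) auto
  moreover have "Re (beta R d a lam kc 2 x) < 0" if "0 < x" "x < lc" for x
    using that q_kc_below[OF that] c_pos[of x kc] b by (intro Re_beta_neg) auto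
  moreover have "Re (beta R d a lam m l x) < 0"
    if "0 < x" "x < lc + \<epsilon>" "lam m \<noteq> lam kc" for m l x
    using that q_pos[OF that] c_pos[of x m] b by (intro Re_beta_neg) auto
  moreover have "Re (beta R d a lam kc 1 x) < 0" if "0 < x" for x
    using b[OF that] disc[OF that] by (rule Re_beta_1_neg)
  ultimately show ?thesis using real lc_pos by (meson less_trans)
qed

end
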